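(* Let $I$ be a nonempty open interval in $\mathbb{R}$, and let $\phi:I\to\mathbb{R}$ be a function such that $\lambda_\phi(\xi_0):=\lim_{\xi\to\xi_0}\frac{\phi(\xi)-\phi(\xi_0)}{\xi-\xi_0}$ exists in $\mathbb{R}$ for each $\xi_0\in I$. Then the function $f:m_{\approx}(I)\to\widehat{\mathbb{R}}$, defined by $f(x):=\phi(\sigma x)+\lambda_\phi(\sigma x)\,dx$, is the unique indiscernible extension of $\phi$ differentiable on $m_{\approx}(I)$.
   Context: $\widehat{\mathbb{R}}$ is the set of all convergent sequences of real numbers; a real number is identified with the corresponding constant sequence, so $\mathbb{R}\subseteq\widehat{\mathbb{R}}$. $\sigma x\in\mathbb{R}$ is the limit of $x$; $x\approx y$ means $\sigma x=\sigma y$; $dx:=x-\sigma x$. For $x=(\xi_n),y=(\eta_n)$: $x+y:=(\xi_n+\eta_n)$, $xy:=(\sigma x\,\eta_n+\sigma y\,\xi_n-\sigma x\,\sigma y)$. $m_{\approx}(x):=\{y\in\widehat{\mathbb{R}}\mid y\approx x\}$ and $m_{\approx}(A):=\bigcup_{x\in A}m_{\approx}(x)$ for $A\subseteq\widehat{\mathbb{R}}$. A function $f:m_{\approx}(I)\to\widehat{\mathbb{R}}$ is an indiscernible extension of $\phi:I\to\mathbb{R}$ iff $f(\sigma x)=\phi(\sigma x)$ and $f(x)\approx\phi(\sigma x)$ for all $x\in m_{\approx}(I)$. Such an $f$ is differentiable at $\xi_0\in I$ iff there is a real number $\alpha$ with $f(x)=\phi(\xi_0)+\alpha\,dx$ for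 all $x\in m_{\approx}(\xi_0)$, with the proviso that $\alpha=\lim_{\xi\to\xi_0}\frac{\phi(\xi)-\phi(\xi_0)}{\xi-\xi_0}$ whenever this (usual) limit exists in $\mathbb{R}$. $f$ is differentiable on $m_{\approx}(I)$ iff it is differentiable at each $\xi_0\in I$. *)

theory Defs
  imports "HOL-Analysis.Analysis"
begin

typedef rhat = "{x :: nat \<Rightarrow> real. convergent x}"
  morphisms seq_of Abs_rhat
  by (auto intro: convergent_const)

setup_lifting type_definition_rhat

text \<open>The embedding by which a real number is identified with a constant sequence.\<close>

lift_definition const :: "real \<Rightarrow> rhat" is "\<lambda>r _. r"
  by (rule convergent_const)

lift_definition std :: "rhat \<Rightarrow> real" is lim .

lemma std_const [simp]: "std (const r) = r"
  by transfer simp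

text \<open>
  Addition is pointwise, but multiplication is not: the second-order term of the pointwise
  product is dropped, so that a product of two null sequences is 0.
\<close>

instantiation rhat :: comm_ring_1
begin

lift_definition zero_rhat :: rhat is "\<lambda>_. 0"
  by (rule convergent_const)

lift_definition one_rhat :: rhat is "\<lambda>_. 1"
  by (rule convergent_const)

lift_definition plus_rhat :: "rhat \<Rightarrow> rhat \<Rightarrow> rhat" is "\<lambda>x y n. x n + y n"
  by (rule convergent_add)

lift_definition uminus_rhat :: "rhat \<Rightarrow> rhat" is "\<lambda>x n. - x n"
  by (simp add: convergent_minus_iff [symmetric])

lift_definition minus_rhat :: "rhat \<Rightarrow> rhat \<Rightarrow> rhat" is "\<lambda>x y n. x n - y n"
  by (rule convergent_diff)

lift_definition times_rhat :: "rhat \<Rightarrow> rhat \<Rightarrow> rhat"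
  is "\<lambda>x y n. lim x * y n + lim y * x n - lim x * lim y"
  by (intro convergent_add convergent_diff convergent_mult convergent_const)

instance
proof
  have lim_times: "lim (\<lambda>n. lim x * y n + lim y * x n - lim x * lim y) = lim x * lim y"
    if "convergent x" "convergent y" for x y :: "nat \<Rightarrow> real"
  proof (rule limI)
    have "x \<longlonglongrightarrow> lim x" "y \<longlonglongrightarrow> lim y"
      using that by (simp_all add: convergent_LIMSEQ_iff)
    then have "(\<lambda>n. lim x * y n + lim y * x n - lim x * lim y)
        \<longlonglongrightarrow> lim x * lim y + lim y * lim x - lim x * lim y"
      by (intro tendsto_intros)
    then show "(\<lambda>n. lim x * y n + lim y * x n - lim x * lim y) \<longlonglongrightarrow> lim x * lim y"
      by simp
  qed
  have lim_plus: "lim (\<lambda>n. x n + y n) = lim x + lim y"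
    if "convergent x" "convergent y" for x y :: "nat \<Rightarrow> real"
    using that by (intro limI tendsto_add) (simp_all add: convergent_LIMSEQ_iff)
  fix a b c :: rhat
  show "a + b + c = a + (b + c)" by transfer (simp add: algebra_simps)
  show "a + b = b + a" by transfer (simp add: algebra_simps)
  show "0 + a = a" by transfer simp
  show "- a + a = 0" by transfer simp
  show "a - b = a + - b" by transfer simp
  show "a * b * c = a * (b * c)"
    by transfer (simp add: lim_times fun_eq_iff, simp add: algebra_simps)
  show "a * b = b * a" by transfer (simp add: algebra_simps)
  show "1 * a = a" by transfer simp
  show "(a + b) * c = a * c + b * c"
    by transfer (simp add: lim_plus fun_eq_iff, simp add: algebra_simps)
  show "(0 :: rhat) \<noteq> 1" by transfer (simp add: fun_eq_iff)
qed

end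

definition indisc :: "rhat \<Rightarrow> rhat \<Rightarrow> bool"
  where "indisc x y \<longleftrightarrow> std x = std y"

definition infinitesimal_part :: "rhat \<Rightarrow> rhat"
  where "infinitesimal_part x = x - const (std x)"

definition monad :: "rhat \<Rightarrow> rhat set"
  where "monad x = {y. indisc y x}"

definition monad_set :: "rhat set \<Rightarrow> rhat set"
  where "monad_set A = (\<Union>x\<in>A. monad x)"

definition diff_quotient :: "(real \<Rightarrow> real) \<Rightarrow> real \<Rightarrow> real \<Rightarrow> real"
  where "diff_quotient \<phi> \<xi>0 \<xi> = (\<phi> \<xi> - \<phi> \<xi>0) / (\<xi> - \<xi>0)"

text \<open>
  Maps defined on \<open>I\<close> or on \<open>monad_set (const ` I)\<close> are represented by total functions
  whose values elsewhere are never consulted; accordingly limits are taken within \<open>I\<close>.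
\<close>

definition has_slope :: "real set \<Rightarrow> (real \<Rightarrow> real) \<Rightarrow> real \<Rightarrow> bool"
  where "has_slope I \<phi> \<xi>0 \<longleftrightarrow> (\<exists>L. (diff_quotient \<phi> \<xi>0 \<longlongrightarrow> L) (at \<xi>0 within I))"

definition slope :: "real set \<Rightarrow> (real \<Rightarrow> real) \<Rightarrow> real \<Rightarrow> real"
  where "slope I \<phi> \<xi>0 = Lim (at \<xi>0 within I) (diff_quotient \<phi> \<xi>0)"

definition indisc_extension :: "real set \<Rightarrow> (real \<Rightarrow> real) \<Rightarrow> (rhat \<Rightarrow> rhat) \<Rightarrow> bool"
  where "indisc_extension I \<phi> f \<longleftrightarrow>
    (\<forall>x \<in> monad_set (const ` I).
       f (const (std x)) = const (\<phi> (std x)) \<and> indisc (f x) (const (\<phi> (std x))))"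

definition hat_differentiable_at ::
  "real set \<Rightarrow> (real \<Rightarrow> real) \<Rightarrow> (rhat \<Rightarrow> rhat) \<Rightarrow> real \<Rightarrow> bool"
  where "hat_differentiable_at I \<phi> f \<xi>0 \<longleftrightarrow>
    (\<exists>\<alpha>. (\<forall>x \<in> monad (const \<xi>0). f x = const (\<phi> \<xi>0) + const \<alpha> * infinitesimal_part x) \<and>
         (has_slope I \<phi> \<xi>0 \<longrightarrow> \<alpha> = slope I \<phi> \<xi>0))"

definition hat_differentiable_on ::
  "real set \<Rightarrow> (real \<Rightarrow> real) \<Rightarrow> (rhat \<Rightarrow> rhat) \<Rightarrow> bool"
  where "hat_differentiable_on I \<phi> f \<longleftrightarrow> (\<forall>\<xi>0\<in>I. hat_differentiable_at I \<phi> f \<xi>0)"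

end

theory Submission
  imports Defs
begin

text \<open>On each monad differentiability makes the map affine in
  \<open>infinitesimal_part x\<close>, and since the slope exists, the proviso leaves no freedom in
  the coefficient: this gives uniqueness. That the formula extends \<phi> holds because
  \<open>std\<close> is additive and multiplicative and kills infinitesimal parts, which vanish at
  constants.\<close>

lemma std_add: "std (x + y) = std x + std y"
  by transfer (auto intro!: limI tendsto_add simp: convergent_LIMSEQ_iff)

lemma std_diff: "std (x - y) = std x - std y"
  by transfer (auto intro!: limI tendsto_diff simp: convergent_LIMSEQ_iff)

text \<open>The second-order term dropped from the pointwise product is a product of two null
  sequences, so it does not affect the limit.\<close>

lemma std_mult: "std (x * y) = std x * std y"
proof transfer
  fix x y :: "nat \<Rightarrow> real"
  assume "convergent x" "convergent y"
  then have "x \<longlonglongrightarrow> lim x" "y \<longlonglongrightarrow> lim y"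
    by (simp_all add: convergent_LIMSEQ_iff)
  then have "(\<lambda>n. lim x * y n + lim y * x n - lim x * lim y)
      \<longlonglongrightarrow> lim x * lim y + lim y * lim x - lim x * lim y"
    by (intro tendsto_intros)
  then show "lim (\<lambda>n. lim x * y n + lim y * x n - lim x * lim y) = lim x * lim y"
    by (intro limI) simp
qed

lemma std_infinitesimal_part [simp]: "std (infinitesimal_part x) = 0"
  by (simp add: infinitesimal_part_def std_diff)

lemma infinitesimal_part_const [simp]: "infinitesimal_part (const r) = 0"
  by (simp add: infinitesimal_part_def)

lemma mem_monad_const_iff [simp]: "x \<in> monad (const r) \<longleftrightarrow> std x = r"
  by (simp add: monad_def indisc_def)

lemma mem_monad_set_const_iff [simp]: "x \<in> monad_set (const ` A) \<longleftrightarrow> std x \<in> A"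
  by (auto simp: monad_set_def)

theorem proposition5p27:
  fixes I :: "real set" and \<phi> :: "real \<Rightarrow> real" and f :: "rhat \<Rightarrow> rhat"
  assumes "open I" and "is_interval I" and "I \<noteq> {}"
    and "\<And>\<xi>0. \<xi>0 \<in> I \<Longrightarrow> has_slope I \<phi> \<xi>0"
    and "\<And>x. x \<in> monad_set (const ` I) \<Longrightarrow>
      f x = const (\<phi> (std x)) + const (slope I \<phi> (std x)) * infinitesimal_part x"
  shows "indisc_extension I \<phi> f \<and> hat_differentiable_on I \<phi> f \<and>
    (\<forall>g. indisc_extension I \<phi> g \<and> hat_differentiable_on I \<phi> g \<longrightarrow>
      (\<forall>x \<in> monad_set (const ` I). g x = f x))"
proof (intro conjI allI impI ballI)
  show "indisc_extension I \<phi> f"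
    by (simp add: indisc_extension_def indisc_def assms(5) std_add std_mult)
  \<comment> \<open>The witness for \<alpha> is \<open>slope I \<phi> \<xi>0\<close>, which meets
    the proviso trivially.\<close>
  show "hat_differentiable_on I \<phi> f"
    by (auto simp: hat_differentiable_on_def hat_differentiable_at_def assms(5))
  fix g x
  assume "indisc_extension I \<phi> g \<and> hat_differentiable_on I \<phi> g"
    and x: "x \<in> monad_set (const ` I)"
  then have "hat_differentiable_at I \<phi> g (std x)" and "has_slope I \<phi> (std x)"
    using assms(4) by (simp_all add: hat_differentiable_on_def)
  \<comment> \<open>As the slope exists at \<open>std x\<close>, the proviso identifies the unknown
    coefficient of \<open>g\<close> on this monad with it.\<close>
  then have "g x = const (\<phi> (std x)) + const (slope I \<phi> (std x)) * infinitesimal_part x"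
    by (auto simp: hat_differentiable_at_def)
  with assms(5)[OF x] show "g x = f x"
    by simp
qed

end
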